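(* Let $\ell$ and $m$ be non-negative integers with $2^\ell\le m<2^{\ell+1}$. Then, for every integer $p$ with $1\le p\le \ell+2$, $$M_{1,p}\,c_m=\sum_{j=0}^{p-1}(-1)^jM_{\frac{1}{2^{j+1}},\,p-(j+1)}\,Q_{\frac{1}{2^j}}\,c_{m\,(\mathrm{mod}\,2^j)}+(-1)^pc_m,$$ and, for every integer $p\ge \ell+3$, $$M_{1,p}\,c_m=\sum_{j=0}^{\ell+1}(-1)^jM_{\frac{1}{2^{j+1}},\,p-(j+1)}\,Q_{\frac{1}{2^j}}\,c_{m\,(\mathrm{mod}\,2^j)}+(-1)^{\ell+2}M_{\frac{1}{2^{\ell+2}},\,p-(\ell+2)}\,c_m .$$
   Context: Let $\psi(x)=\frac{1}{\sqrt{2\pi}}e^{-x^2/2}$. For an integer $m$, $c_m(x)=\cos(2\pi mx)$, $x\in\mathbb R$; $m\,(\mathrm{mod}\,2^j)$ denotes the remainder of $m$ on division by $2^j$, lying in $\{0,\ldots,2^j-1\}$. For a positive integer $n$ and a $1$-periodic continuous function $f$ on $\mathbb R$, the quasi-interpolant is $Q_{\frac1n}(f)(x)=\sum_{\ell\in\mathbb Z}f\left(\frac{\ell}{n}\right)\psi(nx-\ell)$, and the error operator is $E_{\frac1n}(f)=Q_{\frac1n}(f)-f$. The multilevel error operators are defined recursively by $M_{\frac1n,0}=I$ (the identity) and $M_{\frac1n,p}(f)=E_{\frac{1}{2^{p-1}n}}\bigl(M_{\frac1n,p-1}(f)\bigr)$ for $p\ge1$; $M_{1,p}$ is the case $n=1$.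 *)

theory Defs
  imports "HOL-Analysis.Analysis"
begin

definition psi :: "real \<Rightarrow> real" where
  "psi x = 1 / sqrt (2 * pi) * exp (- x\<^sup>2 / 2)"

definition cos_fun :: "int \<Rightarrow> real \<Rightarrow> real" where
  "cos_fun m x = cos (2 * pi * of_int m * x)"

text \<open>
  The operators are indexed by the reciprocal \<open>n\<close> of the mesh size \<open>1/n\<close>, with \<open>n > 0\<close>.
  They are total on \<open>real \<Rightarrow> real\<close>, and meant for \<open>1\<close>-periodic continuous functions. Such
  functions are bounded, so the series below converges absolutely at every point.
\<close>

definition quasi_interp :: "nat \<Rightarrow> (real \<Rightarrow> real) \<Rightarrow> real \<Rightarrow> real" where
  "quasi_interp n f x = (\<Sum>\<^sub>\<infinity>l::int. f (of_int l / of_nat n) * psi (of_nat n * x - of_int l))"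

definition qi_error :: "nat \<Rightarrow> (real \<Rightarrow> real) \<Rightarrow> real \<Rightarrow> real" where
  "qi_error n f x = quasi_interp n f x - f x"

fun multilevel_error :: "nat \<Rightarrow> nat \<Rightarrow> (real \<Rightarrow> real) \<Rightarrow> real \<Rightarrow> real" where
  "multilevel_error n 0 f = f"
| "multilevel_error n (Suc p) f = qi_error (2 ^ p * n) (multilevel_error n p f)"

end

(*
  Peeling off the coarsest level gives M_{1/n,p+1} f = M_{1/(2n),p} (Q_{1/n} f - f). The Gaussian
  decays fast enough that Q_{1/n} maps bounded functions to bounded functions and is linear on them,
  so the right-hand side splits. Repeating this K times gives an identity valid for every K \<le> p and
  every bounded f. For f = c_m, the operator Q_{1/2^j} samples only at multiples of 1/2^j, where c_m
  agrees with c_{m mod 2^j}. The two claims are the cases K = p and K = l + 2.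
*)
theory Submission
  imports Defs
begin

text \<open>Each half-line of integers carries a geometric series of ratio \<open>exp (-1)\<close>.
  The halves share 0, which is harmless for summability of the union.\<close>

lemma summable_on_exp_neg_abs_int: "(\<lambda>l::int. exp (- \<bar>real_of_int l\<bar>)) summable_on UNIV"
proof -
  have "summable (\<lambda>k. exp (-1::real) ^ k)"
    by (rule summable_geometric) simp
  then have nat: "(\<lambda>k::nat. exp (- real k)) summable_on UNIV"
    by (subst summable_on_UNIV_nonneg_real_iff) (simp_all flip: exp_of_nat_mult)
  have "(\<lambda>l::int. exp (- \<bar>real_of_int l\<bar>)) summable_on range int"
    using nat by (subst summable_on_reindex) (auto simp: o_def)
  moreover have "(\<lambda>l::int. exp (- \<bar>real_of_int l\<bar>)) summable_on range (\<lambda>k. - int k)"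
    using nat by (subst summable_on_reindex) (auto simp: o_def inj_on_def)
  ultimately have "(\<lambda>l::int. exp (- \<bar>real_of_int l\<bar>)) summable_on range int \<union> range (\<lambda>k. - int k)"
    by (rule summable_on_union)
  moreover have "l \<in> range int \<union> range (\<lambda>k. - int k)" for l
    by (cases l rule: int_cases2) auto
  then have "range int \<union> range (\<lambda>k. - int k) = UNIV"
    by blast
  ultimately show ?thesis by simp
qed

lemma psi_nonneg: "psi x \<ge> 0"
  by (simp add: psi_def)

text \<open>Completing the square trades the Gaussian for a two-sided exponential, whose integer
  translates sum geometrically.\<close>

lemma psi_le_exp_neg_abs: "psi x \<le> exp (1/2 - \<bar>x\<bar>)"
proof -
  have "0 \<le> (\<bar>x\<bar> - 1)\<^sup>2"
    by simp
  then have "- x\<^sup>2 / 2 \<le> 1/2 - \<bar>x\<bar>"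
    by (simp add: power2_diff)
  moreover have "1 / sqrt (2 * pi) \<le> 1"
    using pi_gt3 by simp
  ultimately show ?thesis
    unfolding psi_def using mult_mono[of "1 / sqrt (2 * pi)" 1 "exp (- x\<^sup>2 / 2)" "exp (1/2 - \<bar>x\<bar>)"]
    by simp
qed

text \<open>Rounding \<open>x\<close> down to an integer costs at most 1 in the exponent, so 1/2
  becomes 3/2. In exchange the majorant is an integer translate of one fixed summable
  family.\<close>

lemma psi_shift_le: "psi (x - of_int l) \<le> exp (3/2) * exp (- \<bar>real_of_int (l - \<lfloor>x\<rfloor>)\<bar>)"
proof -
  have "1/2 - \<bar>x - of_int l\<bar> \<le> 3/2 - \<bar>real_of_int (l - \<lfloor>x\<rfloor>)\<bar>"
    by (simp, linarith)
  then have "exp (1/2 - \<bar>x - of_int l\<bar>) \<le> exp (3/2 - \<bar>real_of_int (l - \<lfloor>x\<rfloor>)\<bar>)"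
    by simp
  then show ?thesis
    unfolding mult_exp_exp using order_trans[OF psi_le_exp_neg_abs] by simp
qed

text \<open>By translation invariance of sums over the integers, the value does not involve the
  centre \<open>k\<close>; this makes the later bounds uniform in \<open>x\<close>.\<close>

lemma has_sum_psi_shift_majorant:
  "((\<lambda>l::int. exp (3/2) * exp (- \<bar>real_of_int (l - k)\<bar>)) has_sum
     (exp (3/2) * (\<Sum>\<^sub>\<infinity>l::int. exp (- \<bar>real_of_int l\<bar>)))) UNIV"
proof -
  have "((\<lambda>l::int. exp (- \<bar>real_of_int l\<bar>)) has_sum (\<Sum>\<^sub>\<infinity>l::int. exp (- \<bar>real_of_int l\<bar>))) UNIV"
    using summable_on_exp_neg_abs_int by (rule has_sum_infsum)
  also have "?this \<longleftrightarrow> ((\<lambda>l::int. exp (- \<bar>real_of_int (l - k)\<bar>)) has_sum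
      (\<Sum>\<^sub>\<infinity>l::int. exp (- \<bar>real_of_int l\<bar>))) UNIV"
    by (rule has_sum_reindex_bij_witness[of _ "\<lambda>l. l - k" "\<lambda>l. l + k"]) auto
  finally show ?thesis
    by (rule has_sum_cmult_right)
qed

lemma abs_quasi_interp_term_le:
  fixes f :: "real \<Rightarrow> real"
  assumes "\<And>x. \<bar>f x\<bar> \<le> B"
  shows "\<bar>f (of_int l / of_nat n) * psi (x - of_int l)\<bar> \<le>
    B * (exp (3/2) * exp (- \<bar>real_of_int (l - \<lfloor>x\<rfloor>)\<bar>))"
  unfolding abs_mult abs_of_nonneg[OF psi_nonneg]
  \<comment> \<open>The \<open>order_trans\<close> argument supplies 0 \<le> \<open>B\<close>, from
    0 \<le> \<open>\<bar>f x\<bar>\<close> \<le> \<open>B\<close>.\<close>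
  by (rule mult_mono[OF assms psi_shift_le order_trans[OF abs_ge_zero assms] psi_nonneg])

lemma quasi_interp_summable:
  fixes f :: "real \<Rightarrow> real"
  assumes "bounded (range f)"
  shows "(\<lambda>l::int. f (of_int l / of_nat n) * psi (of_nat n * x - of_int l)) summable_on UNIV"
proof -
  obtain B where B: "\<And>x. \<bar>f x\<bar> \<le> B"
    using assms by (auto simp: bounded_iff)
  show ?thesis
    by (rule abs_summable_summable, rule Infinite_Sum.abs_summable_on_comparison_test'[OF has_sum_imp_summable
          [OF has_sum_cmult_right[OF has_sum_psi_shift_majorant, of B "\<lfloor>of_nat n * x\<rfloor>"]]])
      (unfold real_norm_def, rule abs_quasi_interp_term_le[OF B])
qed

text \<open>Boundedness is the invariant that keeps the defining series summable when the operators
  are iterated.\<close>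

lemma bounded_quasi_interp:
  assumes "bounded (range f)"
  shows "bounded (range (quasi_interp n f))"
proof -
  obtain B where B: "\<And>x. \<bar>f x\<bar> \<le> B"
    using assms by (auto simp: bounded_iff)
  have "norm (quasi_interp n f x) \<le> B * (exp (3/2) * (\<Sum>\<^sub>\<infinity>l::int. exp (- \<bar>real_of_int l\<bar>)))" for x
    unfolding quasi_interp_def
    by (rule norm_infsum_le[OF has_sum_infsum[OF quasi_interp_summable[OF assms]]
          has_sum_cmult_right[OF has_sum_psi_shift_majorant, of B "\<lfloor>of_nat n * x\<rfloor>"]])
      (use abs_quasi_interp_term_le[OF B] in auto)
  then show ?thesis
    unfolding bounded_iff by blast
qed

text \<open>An infinite sum defaults to 0 for a non-summable family, so splitting it rests on the
  summability that boundedness provides.\<close>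

lemma quasi_interp_diff:
  assumes "bounded (range f)" "bounded (range g)"
  shows "quasi_interp n (\<lambda>x. f x - g x) x = quasi_interp n f x - quasi_interp n g x"
proof -
  let ?w = "\<lambda>h (l::int). h (of_int l / of_nat n :: real) * psi (of_nat n * x - of_int l)"
  have "infsum (\<lambda>l. ?w f l + - ?w g l) UNIV = infsum (?w f) UNIV + infsum (\<lambda>l. - ?w g l) UNIV"
    using assms by (intro infsum_add) (simp_all only: summable_on_uminus quasi_interp_summable)
  then show ?thesis
    by (simp add: quasi_interp_def left_diff_distrib infsum_uminus)
qed

lemma bounded_qi_error:
  assumes "bounded (range f)"
  shows "bounded (range (qi_error n f))"
  unfolding qi_error_def[abs_def]
  by (rule bounded_minus_comp[OF bounded_quasi_interp[OF assms] assms])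

lemma bounded_multilevel_error:
  assumes "bounded (range f)"
  shows "bounded (range (multilevel_error n p f))"
  using assms
proof (induction p)
  case (Suc p)
  then show ?case
    using bounded_qi_error[OF Suc.IH, of "2 ^ p * n"] by simp
qed simp

text \<open>Linearity passes through each level because the iterates of \<open>f\<close> and
  \<open>g\<close> stay bounded.\<close>

lemma multilevel_error_diff:
  assumes "bounded (range f)" "bounded (range g)"
  shows "multilevel_error n p (\<lambda>x. f x - g x) =
    (\<lambda>x. multilevel_error n p f x - multilevel_error n p g x)"
proof (induction p)
  case (Suc p)
  show ?case
    by (auto simp: Suc qi_error_def quasi_interp_diff bounded_multilevel_error assms fun_eq_iff)
qed simp

text \<open>The recursion applies the finest level last. Both sides are the same composition of
  error operators, rebracketed so that the coarsest one stands alone next to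
  \<open>f\<close>.\<close>

lemma multilevel_error_Suc_coarse:
  "multilevel_error n (Suc p) f = multilevel_error (2 * n) p (qi_error n f)"
proof (induction p)
  case (Suc p)
  have "multilevel_error n (Suc (Suc p)) f = qi_error (2 ^ Suc p * n) (multilevel_error n (Suc p) f)"
    by simp
  also have "\<dots> = multilevel_error (2 * n) (Suc p) (qi_error n f)"
    unfolding Suc by (simp add: mult_ac)
  finally show ?case .
qed simp

lemma multilevel_error_expand:
  assumes "bounded (range f)" "K \<le> p"
  shows "multilevel_error n p f x =
    (\<Sum>j<K. (-1) ^ j * multilevel_error (2 ^ (j + 1) * n) (p - (j + 1)) (quasi_interp (2 ^ j * n) f) x)
    + (-1) ^ K * multilevel_error (2 ^ K * n) (p - K) f x"
  using assms(2)
proof (induction K)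
  case (Suc K)
  \<comment> \<open>At least one level remains in the last term, so its coarsest error can be peeled
    off. The \<open>- f\<close> in that error flips the sign of the new remainder.\<close>
  then have "p - K = Suc (p - Suc K)"
    by simp
  then have "multilevel_error (2 ^ K * n) (p - K) f x =
      multilevel_error (2 ^ Suc K * n) (p - Suc K) (\<lambda>x. quasi_interp (2 ^ K * n) f x - f x) x"
    by (simp only: multilevel_error_Suc_coarse qi_error_def[abs_def] power_Suc mult.assoc)
  also have "\<dots> = multilevel_error (2 ^ Suc K * n) (p - Suc K) (quasi_interp (2 ^ K * n) f) x
      - multilevel_error (2 ^ Suc K * n) (p - Suc K) f x"
    using assms(1) by (simp add: multilevel_error_diff bounded_quasi_interp)
  finally have step: "multilevel_error (2 ^ K * n) (p - K) f x = \<dots>" .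
  have "K \<le> p"
    using Suc.prems by simp
  then show ?case
    using Suc.IH unfolding step sum.lessThan_Suc by (simp add: right_diff_distrib)
qed simp

lemma bounded_cos_fun: "bounded (range (cos_fun m))"
  unfolding bounded_iff cos_fun_def by (intro exI[of _ 1]) auto

text \<open>Aliasing: the frequencies differ by a multiple of \<open>n\<close>, so at
  \<open>k / n\<close> the phases differ by an integer multiple of \<open>2 * pi\<close>.\<close>

lemma cos_fun_mod_sample:
  assumes "n > 0"
  shows "cos_fun (m mod int n) (of_int k / of_nat n) = cos_fun m (of_int k / of_nat n)"
proof -
  have "real_of_int m = real_of_int (m mod int n) + real n * real_of_int (m div int n)"
    by (metis of_int_add of_int_mult of_int_of_nat_eq mod_mult_div_eq)
  then have "2 * pi * of_int m * (of_int k / of_nat n) =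
      2 * pi * of_int (m mod int n) * (of_int k / of_nat n) + 2 * pi * of_int (m div int n * k)"
    using assms by (simp add: field_simps)
  moreover have "cos (y + 2 * pi * of_int i) = cos y" for y i
    by (simp add: cos_add)
  ultimately show ?thesis
    by (simp only: cos_fun_def)
qed

lemma quasi_interp_cos_fun_mod:
  assumes "n > 0"
  shows "quasi_interp n (cos_fun (m mod int n)) = quasi_interp n (cos_fun m)"
  unfolding quasi_interp_def[abs_def] cos_fun_mod_sample[OF assms] ..

theorem proposition2:
  fixes l m :: nat
  assumes "2 ^ l \<le> m" and "m < 2 ^ (l + 1)"
  shows "(\<forall>p. 1 \<le> p \<and> p \<le> l + 2 \<longrightarrow>
      multilevel_error 1 p (cos_fun (int m)) =
        (\<lambda>x. (\<Sum>j = 0..p - 1. (-1) ^ j *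
                multilevel_error (2 ^ (j + 1)) (p - (j + 1))
                  (quasi_interp (2 ^ j) (cos_fun (int m mod 2 ^ j))) x)
             + (-1) ^ p * cos_fun (int m) x))
    \<and> (\<forall>p. p \<ge> l + 3 \<longrightarrow>
      multilevel_error 1 p (cos_fun (int m)) =
        (\<lambda>x. (\<Sum>j = 0..l + 1. (-1) ^ j *
                multilevel_error (2 ^ (j + 1)) (p - (j + 1))
                  (quasi_interp (2 ^ j) (cos_fun (int m mod 2 ^ j))) x)
             + (-1) ^ (l + 2) *
                multilevel_error (2 ^ (l + 2)) (p - (l + 2)) (cos_fun (int m)) x))"
proof -
  have expand: "multilevel_error 1 p (cos_fun (int m)) x =
      (\<Sum>j<K. (-1) ^ j * multilevel_error (2 ^ (j + 1)) (p - (j + 1))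
         (quasi_interp (2 ^ j) (cos_fun (int m mod 2 ^ j))) x)
      + (-1) ^ K * multilevel_error (2 ^ K) (p - K) (cos_fun (int m)) x" if "K \<le> p" for K p x
    using multilevel_error_expand[OF bounded_cos_fun that, of 1 "int m" x]
      quasi_interp_cos_fun_mod[of "2 ^ j" "int m" for j] by simp
  show ?thesis
  proof (intro conjI allI impI ext)
    fix p x assume "1 \<le> p \<and> p \<le> l + 2"
    \<comment> \<open>Here 1 \<le> \<open>p\<close> matters: subtraction truncates, so for
      \<open>p = 0\<close> the left side would be \<open>{0}\<close>.\<close>
    then have "{0..p - 1} = {..<p}"
      by auto
    \<comment> \<open>With \<open>K = p\<close> no level is left in the remainder, which is then
      \<open>cos_fun (int m)\<close> itself up to sign.\<close>
    with expand[of p p x] show "multilevel_error 1 p (cos_fun (int m)) x =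
      (\<Sum>j = 0..p - 1. (-1) ^ j * multilevel_error (2 ^ (j + 1)) (p - (j + 1))
         (quasi_interp (2 ^ j) (cos_fun (int m mod 2 ^ j))) x) + (-1) ^ p * cos_fun (int m) x"
      by simp
  next
    \<comment> \<open>Stopping at \<open>K = l + 2\<close> < \<open>p\<close> leaves a remainder
      with at least one level.\<close>
    fix p x assume "l + 3 \<le> p"
    moreover have "{0..l + 1} = {..<l + 2}"
      by auto
    ultimately show "multilevel_error 1 p (cos_fun (int m)) x =
      (\<Sum>j = 0..l + 1. (-1) ^ j * multilevel_error (2 ^ (j + 1)) (p - (j + 1))
         (quasi_interp (2 ^ j) (cos_fun (int m mod 2 ^ j))) x)
      + (-1) ^ (l + 2) * multilevel_error (2 ^ (l + 2)) (p - (l + 2)) (cos_fun (int m)) x"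
      using expand[of "l + 2" p x] by (simp only:)
  qed
qed

end
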